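(* Let $S$ be a finite ample semigroup such that for every idempotent $e\in E(S)$ there exists a bijection between the principal one-sided ideals $eS=\{es: s\in S\}$ and $Se=\{se: s\in S\}$. Then $S$ is ample in the symmetric inverse semigroup $\mathcal{I}_S$, and hence is a $(2,1,1)$-subalgebra of $\mathcal{I}_S$; that is, there exists an injective semigroup homomorphism $\phi: S\longrightarrow \mathcal{I}_S$ such that for all $x\in S$ both $(x\phi)(x\phi)^{-1}\in S\phi$ and $(x\phi)^{-1}(x\phi)\in S\phi$.
   Context: Maps are written to the right of their arguments. For a set $X$, $\mathcal{I}_X$ is the symmetric inverse semigroup over $X$: the set of all bijections $\beta$ between subsets $Dom\,\beta$ and $Im\,\beta$ of $X$ (including the empty map), where $\beta\gamma$ is the composition "$\beta$ followed by $\gamma$" on its maximal domain of definition $\{x\in Dom\,\beta : x\beta\in Dom\,\gamma\}$, and $\beta^{-1}$ is the inverse partial bijection. $E(S)$ is the set of idempotents of $S$. A semigroup $S$ is left ample if there are an inverse semigroup $T$ and an injective homomorphism $\phi:S\to T$ such that $(x\phi)(x\phi)^{-1}\in S\phi$ for all $x\in S$. It is right ample if there are an inverse semigroup $T$ and an injective homomorphism $\phi:S\to T$ such that $(x\phi)^{-1}(x\phi)\in S\phi$ for all $x\in S$. It is ample if it is both left ample and right ample, where the inverse semigroups and embeddings witnessing left and right ampleness may be different. A subsemigroup $S$ of an inverse semigroup $T$ is ample in $T$ if $xx^{-1}\in S$ and $x^{-1}x\in S$ for all $x\in S$; equivalently, $S$ is a $(2,1,1)$-type subalgebra of $(T,\cdot,{}^+,{}^*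 )$, where $x^+=xx^{-1}$ and $x^*=x^{-1}x$. *)

theory Defs
  imports "HOL-Algebra.Group"
begin

text \<open>
  Semigroups are carrier-based structures over the HOL-Algebra record of monoids, so that
  \<^const>\<open>hom\<close> and \<^const>\<open>mon\<close> (injective multiplicative maps) apply.  The record
  field for the unit is never mentioned and may hold an arbitrary value.
\<close>

locale alg_semigroup =
  fixes S (structure)
  assumes m_closed: "\<lbrakk>x \<in> carrier S; y \<in> carrier S\<rbrakk> \<Longrightarrow> x \<otimes> y \<in> carrier S"
    and m_assoc: "\<lbrakk>x \<in> carrier S; y \<in> carrier S; z \<in> carrier S\<rbrakk>
      \<Longrightarrow> (x \<otimes> y) \<otimes> z = x \<otimes> (y \<otimes> z)"

definition idempotents :: "('a, 'm) monoid_scheme \<Rightarrow> 'a set"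
  where "idempotents S = {e \<in> carrier S. e \<otimes>\<^bsub>S\<^esub> e = e}"

definition is_sinv :: "('a, 'm) monoid_scheme \<Rightarrow> 'a \<Rightarrow> 'a \<Rightarrow> bool"
  where "is_sinv T x y \<longleftrightarrow>
    y \<in> carrier T \<and> x \<otimes>\<^bsub>T\<^esub> y \<otimes>\<^bsub>T\<^esub> x = x \<and> y \<otimes>\<^bsub>T\<^esub> x \<otimes>\<^bsub>T\<^esub> y = y"

locale inverse_semigroup = alg_semigroup T for T (structure) +
  assumes ex1_sinv: "x \<in> carrier T \<Longrightarrow> \<exists>!y. is_sinv T x y"

text \<open>
  The inverse in the sense of inverse semigroups; it is not the group-theoretic
  \<^const>\<open>m_inv\<close>, which refers to the unit.
\<close>

definition sinv :: "('a, 'm) monoid_scheme \<Rightarrow> 'a \<Rightarrow> 'a"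
  where "sinv T x = (THE y. is_sinv T x y)"

text \<open>
  HOL cannot quantify existentially over the type in which the ambient inverse semigroup
  lives, so that type is an explicit parameter of the following notions.  A premise
  \<open>ample TYPE('b) TYPE('c) S\<close> of a theorem with \<open>'b\<close> and \<open>'c\<close> free makes the
  theorem applicable to witnesses in arbitrary types.
\<close>

definition left_ample :: "'b itself \<Rightarrow> ('a, 'm) monoid_scheme \<Rightarrow> bool"
  where "left_ample _ S \<longleftrightarrow> (\<exists>(T :: 'b monoid) \<phi>. inverse_semigroup T \<and> \<phi> \<in> mon S T \<and>
    (\<forall>x \<in> carrier S. \<phi> x \<otimes>\<^bsub>T\<^esub> sinv T (\<phi> x) \<in> \<phi> ` carrier S))"

definition right_ample :: "'b itself \<Rightarrow> ('a, 'm) monoid_scheme \<Rightarrow> bool"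
  where "right_ample _ S \<longleftrightarrow> (\<exists>(T :: 'b monoid) \<phi>. inverse_semigroup T \<and> \<phi> \<in> mon S T \<and>
    (\<forall>x \<in> carrier S. sinv T (\<phi> x) \<otimes>\<^bsub>T\<^esub> \<phi> x \<in> \<phi> ` carrier S))"

definition ample :: "'b itself \<Rightarrow> 'c itself \<Rightarrow> ('a, 'm) monoid_scheme \<Rightarrow> bool"
  where "ample B C S \<longleftrightarrow> left_ample B S \<and> right_ample C S"

text \<open>
  Maps are written on the right: the product \<open>\<beta>\<gamma>\<close> is \<open>\<beta>\<close> followed by \<open>\<gamma>\<close>,
  hence the swapped order in \<^const>\<open>map_comp\<close>.
\<close>

definition sym_inv_semigroup :: "'a set \<Rightarrow> ('a \<rightharpoonup> 'a) monoid"
  where "sym_inv_semigroup X =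
    \<lparr>carrier = {\<beta>. dom \<beta> \<subseteq> X \<and> ran \<beta> \<subseteq> X \<and> inj_on \<beta> (dom \<beta>)},
     mult = (\<lambda>\<beta> \<gamma>. \<gamma> \<circ>\<^sub>m \<beta>),
     one = (\<lambda>x. if x \<in> X then Some x else None)\<rparr>"

text \<open>
  The abstract inverse in \<open>sym_inv_semigroup X\<close> is the inverse partial bijection.
\<close>

definition pinv :: "('a \<rightharpoonup> 'a) \<Rightarrow> ('a \<rightharpoonup> 'a)"
  where "pinv \<beta> = (\<lambda>y. if \<exists>x. \<beta> x = Some y then Some (THE x. \<beta> x = Some y) else None)"

lemma inj_on_dom_iff:
  "inj_on \<beta> (dom \<beta>) \<longleftrightarrow> (\<forall>x x' y. \<beta> x = Some y \<longrightarrow> \<beta> x' = Some y \<longrightarrow> x = x')"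
  by (force simp: inj_on_def dom_def)

lemma pinv_Some_iff:
  assumes "inj_on \<beta> (dom \<beta>)"
  shows "pinv \<beta> y = Some x \<longleftrightarrow> \<beta> x = Some y"
proof -
  have "(THE x. \<beta> x = Some y) = x" if "\<beta> x = Some y" for x
    using that assms by (intro the_equality) (auto simp: inj_on_dom_iff)
  then show ?thesis by (auto simp: pinv_def)
qed

lemma is_sinv_sym_inv_semigroup:
  assumes b: "\<beta> \<in> carrier (sym_inv_semigroup X)"
  shows "is_sinv (sym_inv_semigroup X) \<beta> \<gamma> \<longleftrightarrow> \<gamma> = pinv \<beta>"
proof
  have inj: "inj_on \<beta> (dom \<beta>)" using b by (simp add: sym_inv_semigroup_def)
  {
    assume "is_sinv (sym_inv_semigroup X) \<beta> \<gamma>"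
    then have ig: "inj_on \<gamma> (dom \<gamma>)"
      and 1: "\<beta> \<circ>\<^sub>m (\<gamma> \<circ>\<^sub>m \<beta>) = \<beta>" and 2: "\<gamma> \<circ>\<^sub>m (\<beta> \<circ>\<^sub>m \<gamma>) = \<gamma>"
      by (auto simp: is_sinv_def sym_inv_semigroup_def)
    have "\<gamma> y = Some x \<longleftrightarrow> \<beta> x = Some y" for x y
    proof
      assume "\<beta> x = Some y"
      then show "\<gamma> y = Some x"
        using fun_cong[OF 1, of x] inj by (auto simp: map_comp_Some_iff inj_on_dom_iff)
    next
      assume "\<gamma> y = Some x"
      then show "\<beta> x = Some y"
        using fun_cong[OF 2, of y] ig by (auto simp: map_comp_Some_iff inj_on_dom_iff)
    qed
    then have "\<gamma> y = Some x \<longleftrightarrow> pinv \<beta> y = Some x" for x y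
      by (simp add: pinv_Some_iff[OF inj])
    then show "\<gamma> = pinv \<beta>" by (metis ext not_Some_eq)
  }
  assume g: "\<gamma> = pinv \<beta>"
  have iff: "\<gamma> y = Some x \<longleftrightarrow> \<beta> x = Some y" for x y
    using g pinv_Some_iff[OF inj] by simp
  have "inj_on \<gamma> (dom \<gamma>)" using iff by (auto simp: inj_on_dom_iff)
  moreover have "dom \<gamma> \<subseteq> X" "ran \<gamma> \<subseteq> X"
    using b iff by (auto simp: sym_inv_semigroup_def dom_def ran_def)
  moreover have "\<beta> \<circ>\<^sub>m (\<gamma> \<circ>\<^sub>m \<beta>) = \<beta>"
  proof
    fix x show "(\<beta> \<circ>\<^sub>m (\<gamma> \<circ>\<^sub>m \<beta>)) x = \<beta> x"
      using iff by (cases "\<beta> x") (auto simp: map_comp_def split: option.splits)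
  qed
  moreover have "\<gamma> \<circ>\<^sub>m (\<beta> \<circ>\<^sub>m \<gamma>) = \<gamma>"
  proof
    fix x show "(\<gamma> \<circ>\<^sub>m (\<beta> \<circ>\<^sub>m \<gamma>)) x = \<gamma> x"
      using iff by (cases "\<gamma> x") (auto simp: map_comp_def split: option.splits)
  qed
  ultimately show "is_sinv (sym_inv_semigroup X) \<beta> \<gamma>"
    by (simp add: is_sinv_def sym_inv_semigroup_def)
qed

lemma inverse_semigroup_sym_inv_semigroup: "inverse_semigroup (sym_inv_semigroup X)"
proof
  fix \<beta> \<gamma> :: "'a \<rightharpoonup> 'a"
  assume *: "\<beta> \<in> carrier (sym_inv_semigroup X)" "\<gamma> \<in> carrier (sym_inv_semigroup X)"
  have "dom (\<gamma> \<circ>\<^sub>m \<beta>) \<subseteq> dom \<beta>" "ran (\<gamma> \<circ>\<^sub>m \<beta>) \<subseteq> ran \<gamma>"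
    by (auto simp: dom_def ran_def map_comp_Some_iff)
  moreover have "inj_on (\<gamma> \<circ>\<^sub>m \<beta>) (dom (\<gamma> \<circ>\<^sub>m \<beta>))"
    unfolding inj_on_dom_iff
  proof (intro allI impI)
    fix x x' y
    assume "(\<gamma> \<circ>\<^sub>m \<beta>) x = Some y" "(\<gamma> \<circ>\<^sub>m \<beta>) x' = Some y"
    then obtain u u' where u: "\<beta> x = Some u" "\<gamma> u = Some y" "\<beta> x' = Some u'" "\<gamma> u' = Some y"
      unfolding map_comp_Some_iff by blast
    have "inj_on \<gamma> (dom \<gamma>)" "inj_on \<beta> (dom \<beta>)"
      using * by (simp_all add: sym_inv_semigroup_def)
    then have "u = u'" and "u = u' \<Longrightarrow> x = x'"
      using u unfolding inj_on_dom_iff by blast+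
    then show "x = x'" by blast
  qed
  ultimately show "\<beta> \<otimes>\<^bsub>sym_inv_semigroup X\<^esub> \<gamma> \<in> carrier (sym_inv_semigroup X)"
    using * unfolding sym_inv_semigroup_def by simp blast
next
  fix \<beta> \<gamma> \<delta> :: "'a \<rightharpoonup> 'a"
  show "(\<beta> \<otimes>\<^bsub>sym_inv_semigroup X\<^esub> \<gamma>) \<otimes>\<^bsub>sym_inv_semigroup X\<^esub> \<delta> =
      \<beta> \<otimes>\<^bsub>sym_inv_semigroup X\<^esub> (\<gamma> \<otimes>\<^bsub>sym_inv_semigroup X\<^esub> \<delta>)"
    by (auto simp: sym_inv_semigroup_def map_comp_def fun_eq_iff split: option.splits)
next
  fix \<beta> :: "'a \<rightharpoonup> 'a"
  assume "\<beta> \<in> carrier (sym_inv_semigroup X)"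
  then show "\<exists>!\<gamma>. is_sinv (sym_inv_semigroup X) \<beta> \<gamma>"
    by (simp add: is_sinv_sym_inv_semigroup)
qed

lemma sinv_sym_inv_semigroup:
  "\<beta> \<in> carrier (sym_inv_semigroup X) \<Longrightarrow> sinv (sym_inv_semigroup X) \<beta> = pinv \<beta>"
  by (simp add: sinv_def is_sinv_sym_inv_semigroup)

end

theory Submission
  imports Defs
begin

text \<open>
  Let \<open>x\<^sup>+\<close> and \<open>x\<^sup>*\<close> be the idempotents of \<open>S\<close> that correspond to \<open>x x\<inverse>\<close> and \<open>x\<inverse> x\<close>
  in the ambient inverse semigroups.  As for the Vagner--Preston theorem, \<open>S\<close> is represented by
  the right translations \<open>\<rho>\<^sub>x : s \<mapsto> s x\<close>, each restricted to \<open>S x\<^sup>+\<close>.  There \<open>\<rho>\<^sub>x\<close> is injective,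
  because \<open>s x = t x\<close> implies \<open>s x\<^sup>+ = t x\<^sup>+\<close>; the left ample identity \<open>x y\<^sup>+ = (x y)\<^sup>+ x\<close>
  makes \<open>x \<mapsto> \<rho>\<^sub>x\<close> a homomorphism (\<open>right_translation_mult\<close>); and
  \<open>\<rho>\<^sub>x \<rho>\<^sub>x\<inverse>\<close> is the identity on \<open>S x\<^sup>+\<close>, that is \<open>\<rho>\<close> at \<open>x\<^sup>+\<close>.

  On the other side, \<open>\<rho>\<^sub>x\<inverse> \<rho>\<^sub>x\<close> is the identity on \<open>S x\<close>, so what is missing is \<open>S x = S x\<^sup>*\<close>.
  One inclusion holds because \<open>x = x x\<^sup>*\<close>, and counting gives equality: translation by \<open>x\<close> provides
  bijections \<open>S x\<^sup>+ \<rightarrow> S x\<close> and \<open>x\<^sup>* S \<rightarrow> x S\<close>, so with the hypothesis on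
  idempotents
  \[ |S x^+| = |S x| \le |S x^*| = |x^* S| = |x S| \le |x^+ S| = |S x^+| . \]
  Hence all these numbers agree, and finiteness forces \<open>S x = S x\<^sup>*\<close>
  (\<open>left_ideal_eq_idempotent_left_ideal\<close>).
\<close>

section \<open>Inverse semigroups\<close>

context inverse_semigroup
begin

lemma is_sinv_sinv: "x \<in> carrier T \<Longrightarrow> is_sinv T x (sinv T x)"
  unfolding sinv_def by (rule theI'[OF ex1_sinv])

lemma sinv_unique:
  "\<lbrakk>x \<in> carrier T; is_sinv T x y; is_sinv T x z\<rbrakk> \<Longrightarrow> y = z"
  using ex1_sinv by blast

lemma sinv_closed: "x \<in> carrier T \<Longrightarrow> sinv T x \<in> carrier T"
  using is_sinv_sinv by (simp add: is_sinv_def)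

lemma mult_sinv_mult: "x \<in> carrier T \<Longrightarrow> x \<otimes> sinv T x \<otimes> x = x"
  using is_sinv_sinv by (simp add: is_sinv_def)

lemma sinv_mult_sinv: "x \<in> carrier T \<Longrightarrow> sinv T x \<otimes> x \<otimes> sinv T x = sinv T x"
  using is_sinv_sinv by (simp add: is_sinv_def)

lemma mult_sinv_idempotent: "x \<in> carrier T \<Longrightarrow> x \<otimes> sinv T x \<in> idempotents T"
  by (simp add: idempotents_def m_closed sinv_closed m_assoc[symmetric] mult_sinv_mult)

lemma sinv_mult_idempotent: "x \<in> carrier T \<Longrightarrow> sinv T x \<otimes> x \<in> idempotents T"
  by (simp add: idempotents_def m_closed sinv_closed m_assoc[symmetric] sinv_mult_sinv)

text \<open>
  If \<open>x\<close> is the inverse of \<open>e f\<close>, then so is \<open>f x e\<close>, which is idempotent.  By uniqueness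
  \<open>x = f x e\<close>; an idempotent is its own inverse, so \<open>e f = x\<close> is idempotent too.
\<close>

lemma idempotent_mult:
  assumes "e \<in> idempotents T" "f \<in> idempotents T"
  shows "e \<otimes> f \<in> idempotents T"
proof -
  have c: "e \<in> carrier T" "f \<in> carrier T" and e: "e \<otimes> e = e" and f: "f \<otimes> f = f"
    using assms by (simp_all add: idempotents_def)
  define x where "x = sinv T (e \<otimes> f)"
  have ef: "e \<otimes> f \<in> carrier T" using c by (simp add: m_closed)
  have x: "x \<in> carrier T" using ef by (simp add: x_def sinv_closed)
  have ee: "e \<otimes> (e \<otimes> a) = e \<otimes> a" and ff: "f \<otimes> (f \<otimes> a) = f \<otimes> a"
    if "a \<in> carrier T" for a
    using c e f that m_assoc by metis+
  have 1: "e \<otimes> (f \<otimes> (x \<otimes> (e \<otimes> f))) = e \<otimes> f"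
    using mult_sinv_mult[OF ef] c x by (simp add: x_def[symmetric] m_assoc m_closed)
  have 2: "x \<otimes> (e \<otimes> (f \<otimes> x)) = x"
    using sinv_mult_sinv[OF ef] c x by (simp add: x_def[symmetric] m_assoc m_closed)
  have 3: "x \<otimes> (e \<otimes> (f \<otimes> (x \<otimes> e))) = x \<otimes> e"
    using arg_cong[OF 2, of "\<lambda>a. a \<otimes> e"] c x by (simp add: m_assoc m_closed)
  have "is_sinv T (e \<otimes> f) (f \<otimes> x \<otimes> e)"
    using c x by (simp add: is_sinv_def m_assoc m_closed ee ff 1 3)
  moreover have "is_sinv T (e \<otimes> f) x" unfolding x_def by (rule is_sinv_sinv[OF ef])
  ultimately have xf: "x = f \<otimes> x \<otimes> e" using sinv_unique[OF ef] by blast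
  have "(f \<otimes> x \<otimes> e) \<otimes> (f \<otimes> x \<otimes> e) = f \<otimes> x \<otimes> e"
    using c x by (simp add: m_assoc m_closed 3)
  then have xx: "x \<otimes> x = x" using xf by simp
  have "is_sinv T x x" using x xx by (simp add: is_sinv_def)
  moreover have "is_sinv T x (e \<otimes> f)"
    using ef is_sinv_sinv[OF ef] x by (simp add: x_def is_sinv_def)
  ultimately have "e \<otimes> f = x" using sinv_unique[OF x] by blast
  then show ?thesis using x xx by (simp add: idempotents_def)
qed

text \<open>
  Since products of idempotents are idempotent, both \<open>e f\<close> and \<open>f e\<close> are inverses of \<open>e f\<close>.
\<close>

lemma idempotents_commute:
  assumes "e \<in> idempotents T" "f \<in> idempotents T"
  shows "e \<otimes> f = f \<otimes> e"
proof -
  have c: "e \<in> carrier T" "f \<in> carrier T" and e: "e \<otimes> e = e" and f: "f \<otimes> f = f"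
    using assms by (simp_all add: idempotents_def)
  have ef: "e \<otimes> f \<in> carrier T" "(e \<otimes> f) \<otimes> (e \<otimes> f) = e \<otimes> f"
    and fe: "f \<otimes> e \<in> carrier T" "(f \<otimes> e) \<otimes> (f \<otimes> e) = f \<otimes> e"
    using idempotent_mult assms by (simp_all add: idempotents_def)
  have ee: "e \<otimes> (e \<otimes> a) = e \<otimes> a" and ff: "f \<otimes> (f \<otimes> a) = f \<otimes> a"
    if "a \<in> carrier T" for a
    using c e f that m_assoc by metis+
  have "is_sinv T (e \<otimes> f) (e \<otimes> f)" using ef by (simp add: is_sinv_def)
  moreover have "is_sinv T (e \<otimes> f) (f \<otimes> e)"
    using c ef fe by (simp add: is_sinv_def m_assoc m_closed ee ff)
  ultimately show ?thesis using sinv_unique[OF ef(1)] by blast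
qed

lemma sinv_mult:
  assumes c: "x \<in> carrier T" "y \<in> carrier T"
  shows "sinv T (x \<otimes> y) = sinv T y \<otimes> sinv T x"
proof -
  let ?x = "sinv T x" and ?y = "sinv T y"
  have i: "?x \<in> carrier T" "?y \<in> carrier T" using c by (simp_all add: sinv_closed)
  have xy: "x \<otimes> y \<in> carrier T" using c by (simp add: m_closed)
  have comm: "(y \<otimes> ?y) \<otimes> (?x \<otimes> x) = (?x \<otimes> x) \<otimes> (y \<otimes> ?y)"
    using c by (intro idempotents_commute mult_sinv_idempotent sinv_mult_idempotent)
  have "(x \<otimes> y) \<otimes> (?y \<otimes> ?x) \<otimes> (x \<otimes> y) = x \<otimes> ((y \<otimes> ?y) \<otimes> (?x \<otimes> x)) \<otimes> y"
    using c i by (simp add: m_assoc m_closed)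
  also have "\<dots> = (x \<otimes> ?x \<otimes> x) \<otimes> (y \<otimes> ?y \<otimes> y)"
    unfolding comm using c i by (simp add: m_assoc m_closed)
  finally have 1: "(x \<otimes> y) \<otimes> (?y \<otimes> ?x) \<otimes> (x \<otimes> y) = x \<otimes> y"
    using c by (simp add: mult_sinv_mult)
  have "(?y \<otimes> ?x) \<otimes> (x \<otimes> y) \<otimes> (?y \<otimes> ?x) = ?y \<otimes> ((?x \<otimes> x) \<otimes> (y \<otimes> ?y)) \<otimes> ?x"
    using c i by (simp add: m_assoc m_closed)
  also have "\<dots> = (?y \<otimes> y \<otimes> ?y) \<otimes> (?x \<otimes> x \<otimes> ?x)"
    unfolding comm[symmetric] using c i by (simp add: m_assoc m_closed)
  finally have 2: "(?y \<otimes> ?x) \<otimes> (x \<otimes> y) \<otimes> (?y \<otimes> ?x) = ?y \<otimes> ?x"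
    using c by (simp add: sinv_mult_sinv)
  have "is_sinv T (x \<otimes> y) (?y \<otimes> ?x)"
    using 1 2 i by (simp add: is_sinv_def m_closed)
  then show ?thesis using sinv_unique[OF xy is_sinv_sinv[OF xy]] by blast
qed

text \<open>
  With \<open>z\<^sup>+ = z z\<inverse>\<close> this is the left ample identity: \<open>(x y)\<^sup>+ x = x (y y\<inverse>) (x\<inverse> x)\<close>, where
  the two idempotents commute and \<open>x x\<inverse> x = x\<close> absorbs the second one.
\<close>

lemma mult_plus_eq_plus_mult:
  assumes c: "x \<in> carrier T" "y \<in> carrier T"
  shows "x \<otimes> (y \<otimes> sinv T y) = (x \<otimes> y) \<otimes> sinv T (x \<otimes> y) \<otimes> x"
proof -
  let ?x = "sinv T x" and ?y = "sinv T y"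
  have i: "?x \<in> carrier T" "?y \<in> carrier T" using c by (simp_all add: sinv_closed)
  have comm: "(y \<otimes> ?y) \<otimes> (?x \<otimes> x) = (?x \<otimes> x) \<otimes> (y \<otimes> ?y)"
    using c by (intro idempotents_commute mult_sinv_idempotent sinv_mult_idempotent)
  have "(x \<otimes> y) \<otimes> sinv T (x \<otimes> y) \<otimes> x = x \<otimes> ((y \<otimes> ?y) \<otimes> (?x \<otimes> x))"
    using c i by (simp add: sinv_mult m_assoc m_closed)
  also have "\<dots> = (x \<otimes> ?x \<otimes> x) \<otimes> (y \<otimes> ?y)"
    unfolding comm using c i by (simp add: m_assoc m_closed)
  finally show ?thesis using c by (simp add: mult_sinv_mult)
qed

end

section \<open>The operations of left and right ample semigroups\<close>

text \<open>
  Left ampleness expressed inside \<open>S\<close>, with \<open>plus x\<close> in the role of \<open>x\<^sup>+\<close>.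
\<close>

locale left_ample_plus = alg_semigroup S for S (structure) +
  fixes plus :: "'a \<Rightarrow> 'a"
  assumes plus_idempotent: "x \<in> carrier S \<Longrightarrow> plus x \<in> idempotents S"
    and plus_mult: "x \<in> carrier S \<Longrightarrow> plus x \<otimes> x = x"
    and plus_cancel: "\<lbrakk>a \<in> carrier S; b \<in> carrier S; x \<in> carrier S; a \<otimes> x = b \<otimes> x\<rbrakk>
      \<Longrightarrow> a \<otimes> plus x = b \<otimes> plus x"
    and idem_commute: "\<lbrakk>e \<in> idempotents S; f \<in> idempotents S\<rbrakk> \<Longrightarrow> e \<otimes> f = f \<otimes> e"
    and mult_plus: "\<lbrakk>x \<in> carrier S; y \<in> carrier S\<rbrakk> \<Longrightarrow> x \<otimes> plus y = plus (x \<otimes> y) \<otimes> x"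

lemma left_ample_imp_plus:
  fixes B :: "'b itself"
  assumes "alg_semigroup S" "left_ample B S"
  shows "\<exists>plus. left_ample_plus S plus"
proof -
  interpret S: alg_semigroup S by fact
  obtain T :: "'b monoid" and \<phi> where T: "inverse_semigroup T" and mon: "\<phi> \<in> mon S T"
    and im: "\<forall>x \<in> carrier S. \<phi> x \<otimes>\<^bsub>T\<^esub> sinv T (\<phi> x) \<in> \<phi> ` carrier S"
    using assms(2) unfolding left_ample_def by blast
  interpret T: inverse_semigroup T by fact
  have inj: "inj_on \<phi> (carrier S)" and cl: "x \<in> carrier S \<Longrightarrow> \<phi> x \<in> carrier T"
    and mult: "\<lbrakk>x \<in> carrier S; y \<in> carrier S\<rbrakk> \<Longrightarrow> \<phi> (x \<otimes>\<^bsub>S\<^esub> y) = \<phi> x \<otimes>\<^bsub>T\<^esub> \<phi> y" for x y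
    using mon by (auto simp: mon_def hom_def)
  obtain plus where p: "\<And>x. x \<in> carrier S \<Longrightarrow>
      plus x \<in> carrier S \<and> \<phi> (plus x) = \<phi> x \<otimes>\<^bsub>T\<^esub> sinv T (\<phi> x)"
    using im unfolding image_iff by metis
  have eqI: "x = y" if "x \<in> carrier S" "y \<in> carrier S" "\<phi> x = \<phi> y" for x y
    using inj that by (simp add: inj_on_def)
  have "left_ample_plus S plus"
  proof
    fix x assume x: "x \<in> carrier S"
    have "plus x \<otimes>\<^bsub>S\<^esub> plus x = plus x"
      using p x cl T.mult_sinv_idempotent[of "\<phi> x"]
      by (intro eqI) (simp_all add: S.m_closed mult idempotents_def)
    then show "plus x \<in> idempotents S" using p x by (simp add: idempotents_def)
    show "plus x \<otimes>\<^bsub>S\<^esub> x = x"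
      using p x cl by (intro eqI) (simp_all add: S.m_closed mult T.mult_sinv_mult)
  next
    fix a b x
    assume c: "a \<in> carrier S" "b \<in> carrier S" "x \<in> carrier S" and eq: "a \<otimes>\<^bsub>S\<^esub> x = b \<otimes>\<^bsub>S\<^esub> x"
    have "\<phi> a \<otimes>\<^bsub>T\<^esub> \<phi> x \<otimes>\<^bsub>T\<^esub> sinv T (\<phi> x) = \<phi> b \<otimes>\<^bsub>T\<^esub> \<phi> x \<otimes>\<^bsub>T\<^esub> sinv T (\<phi> x)"
      using eq mult c by metis
    then show "a \<otimes>\<^bsub>S\<^esub> plus x = b \<otimes>\<^bsub>S\<^esub> plus x"
      using p c cl by (intro eqI) (simp_all add: S.m_closed mult T.m_assoc T.sinv_closed)
  next
    fix e f assume ef: "e \<in> idempotents S" "f \<in> idempotents S"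
    have "\<phi> g \<in> idempotents T" if "g \<in> idempotents S" for g
      using that cl mult[of g g] by (simp add: idempotents_def)
    then show "e \<otimes>\<^bsub>S\<^esub> f = f \<otimes>\<^bsub>S\<^esub> e"
      using ef T.idempotents_commute
      by (intro eqI) (simp_all add: S.m_closed mult idempotents_def)
  next
    fix x y assume c: "x \<in> carrier S" "y \<in> carrier S"
    then show "x \<otimes>\<^bsub>S\<^esub> plus y = plus (x \<otimes>\<^bsub>S\<^esub> y) \<otimes>\<^bsub>S\<^esub> x"
      using p cl by (intro eqI) (simp_all add: S.m_closed mult T.mult_plus_eq_plus_mult)
  qed
  then show ?thesis by blast
qed

text \<open>Here \<open>e\<close> is \<open>x\<^sup>*\<close>, the idempotent that corresponds to \<open>x\<inverse> x\<close>.\<close>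

lemma right_ample_imp_star:
  fixes B :: "'b itself"
  assumes "alg_semigroup S" "right_ample B S" and x: "x \<in> carrier S"
  obtains e where "e \<in> idempotents S" "x \<otimes>\<^bsub>S\<^esub> e = x"
    "\<And>a b. \<lbrakk>a \<in> carrier S; b \<in> carrier S; x \<otimes>\<^bsub>S\<^esub> a = x \<otimes>\<^bsub>S\<^esub> b\<rbrakk> \<Longrightarrow> e \<otimes>\<^bsub>S\<^esub> a = e \<otimes>\<^bsub>S\<^esub> b"
proof -
  interpret S: alg_semigroup S by fact
  obtain T :: "'b monoid" and \<phi> where T: "inverse_semigroup T" and mon: "\<phi> \<in> mon S T"
    and im: "\<forall>x \<in> carrier S. sinv T (\<phi> x) \<otimes>\<^bsub>T\<^esub> \<phi> x \<in> \<phi> ` carrier S"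
    using assms(2) unfolding right_ample_def by blast
  interpret T: inverse_semigroup T by fact
  have inj: "inj_on \<phi> (carrier S)" and cl: "x \<in> carrier S \<Longrightarrow> \<phi> x \<in> carrier T"
    and mult: "\<lbrakk>x \<in> carrier S; y \<in> carrier S\<rbrakk> \<Longrightarrow> \<phi> (x \<otimes>\<^bsub>S\<^esub> y) = \<phi> x \<otimes>\<^bsub>T\<^esub> \<phi> y" for x y
    using mon by (auto simp: mon_def hom_def)
  have eqI: "x = y" if "x \<in> carrier S" "y \<in> carrier S" "\<phi> x = \<phi> y" for x y
    using inj that by (simp add: inj_on_def)
  obtain e where e: "e \<in> carrier S" "\<phi> e = sinv T (\<phi> x) \<otimes>\<^bsub>T\<^esub> \<phi> x"
    using im x by force
  show thesis
  proof
    have "e \<otimes>\<^bsub>S\<^esub> e = e"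
      using e x cl T.sinv_mult_idempotent[of "\<phi> x"]
      by (intro eqI) (simp_all add: S.m_closed mult idempotents_def)
    then show "e \<in> idempotents S" using e by (simp add: idempotents_def)
    show "x \<otimes>\<^bsub>S\<^esub> e = x"
      using e x cl T.mult_sinv_mult[of "\<phi> x"]
      by (intro eqI) (simp_all add: S.m_closed mult T.m_assoc T.sinv_closed)
  next
    fix a b assume c: "a \<in> carrier S" "b \<in> carrier S" and eq: "x \<otimes>\<^bsub>S\<^esub> a = x \<otimes>\<^bsub>S\<^esub> b"
    have "sinv T (\<phi> x) \<otimes>\<^bsub>T\<^esub> (\<phi> x \<otimes>\<^bsub>T\<^esub> \<phi> a) = sinv T (\<phi> x) \<otimes>\<^bsub>T\<^esub> (\<phi> x \<otimes>\<^bsub>T\<^esub> \<phi> b)"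
      using eq mult c x by metis
    then show "e \<otimes>\<^bsub>S\<^esub> a = e \<otimes>\<^bsub>S\<^esub> b"
      using e x c cl by (intro eqI) (simp_all add: S.m_closed mult T.m_assoc T.sinv_closed)
  qed
qed

context left_ample_plus
begin

lemma plus_closed: "x \<in> carrier S \<Longrightarrow> plus x \<in> carrier S"
  using plus_idempotent by (simp add: idempotents_def)

lemma plus_of_idempotent:
  assumes e: "e \<in> idempotents S" shows "plus e = e"
proof -
  have c: "e \<in> carrier S" "e \<otimes> e = e" using e by (simp_all add: idempotents_def)
  have "e \<otimes> plus e = plus e \<otimes> plus e"
    using c plus_closed plus_mult by (intro plus_cancel) auto
  also have "\<dots> = plus e" using plus_idempotent[OF c(1)] by (simp add: idempotents_def)
  finally show ?thesis
    using idem_commute[OF e plus_idempotent[OF c(1)]] plus_mult[OF c(1)] by simp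
qed

text \<open>
  In the order of idempotents, \<open>(x y)\<^sup>+ \<le> x\<^sup>+\<close>: both are left identities of \<open>x y\<close>, and
  cancelling \<open>x y\<close> to \<open>(x y)\<^sup>+\<close> compares them.
\<close>

lemma plus_mult_plus:
  assumes c: "x \<in> carrier S" "y \<in> carrier S"
  shows "plus (x \<otimes> y) \<otimes> plus x = plus (x \<otimes> y)"
proof -
  have xy: "x \<otimes> y \<in> carrier S" using c by (rule m_closed)
  have "plus x \<otimes> (x \<otimes> y) = x \<otimes> y"
    using c by (simp add: plus_mult plus_closed m_assoc[symmetric])
  then have "plus x \<otimes> (x \<otimes> y) = plus (x \<otimes> y) \<otimes> (x \<otimes> y)"
    by (simp add: plus_mult[OF xy])
  then have "plus x \<otimes> plus (x \<otimes> y) = plus (x \<otimes> y) \<otimes> plus (x \<otimes> y)"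
    using c xy by (intro plus_cancel) (auto simp: plus_closed)
  also have "\<dots> = plus (x \<otimes> y)" using plus_idempotent[OF xy] by (simp add: idempotents_def)
  finally show ?thesis using idem_commute plus_idempotent c xy by metis
qed

section \<open>The representation by restricted right translations\<close>

text \<open>
  The domain \<open>S x\<^sup>+\<close> is written as the set of fixed points of right multiplication by \<open>x\<^sup>+\<close>.
\<close>

definition right_translation :: "'a \<Rightarrow> ('a \<rightharpoonup> 'a)"
  where "right_translation x =
    (\<lambda>s. if s \<in> carrier S \<and> s \<otimes> plus x = s then Some (s \<otimes> x) else None)"

lemma right_translation_Some_iff:
  "right_translation x s = Some t \<longleftrightarrow> s \<in> carrier S \<and> s \<otimes> plus x = s \<and> t = s \<otimes> x"
  by (auto simp: right_translation_def)

lemma inj_right_translation: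
  assumes x: "x \<in> carrier S"
  shows "inj_on (right_translation x) (dom (right_translation x))"
  unfolding inj_on_dom_iff
proof (intro allI impI)
  fix s s' t assume "right_translation x s = Some t" "right_translation x s' = Some t"
  then show "s = s'"
    using plus_cancel[of s s' x] x by (simp add: right_translation_Some_iff)
qed

lemma right_translation_closed:
  assumes x: "x \<in> carrier S"
  shows "right_translation x \<in> carrier (sym_inv_semigroup (carrier S))"
  using inj_right_translation[OF x] x
  by (auto simp: sym_inv_semigroup_def dom_def ran_def right_translation_Some_iff m_closed)

lemma right_translation_idempotent:
  assumes "e \<in> idempotents S"
  shows "right_translation e = (\<lambda>s. if s \<in> carrier S \<and> s \<otimes> e = s then Some s else None)"
  using plus_of_idempotent[OF assms] by (auto simp: right_translation_def)

text \<open>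
  The domain of \<open>\<rho>\<close> at \<open>x y\<close> agrees with that of \<open>\<rho>\<^sub>x \<rho>\<^sub>y\<close>: since \<open>x y\<^sup>+ = (x y)\<^sup>+ x\<close>,
  the condition \<open>s x y\<^sup>+ = s x\<close> says \<open>s (x y)\<^sup>+ x = s x\<close>, and \<open>x\<close> may be cancelled to \<open>x\<^sup>+\<close>.
\<close>

lemma plus_mult_fixed_iff:
  assumes s: "s \<in> carrier S" and c: "x \<in> carrier S" "y \<in> carrier S"
  shows "s \<otimes> plus (x \<otimes> y) = s \<longleftrightarrow> s \<otimes> plus x = s \<and> (s \<otimes> x) \<otimes> plus y = s \<otimes> x"
proof -
  let ?p = "plus (x \<otimes> y)"
  have p: "?p \<in> carrier S" "plus x \<in> carrier S" "plus y \<in> carrier S"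
    using c by (simp_all add: plus_closed m_closed)
  have below: "s \<otimes> ?p \<otimes> plus x = s \<otimes> ?p"
    using s c p by (simp add: m_assoc plus_mult_plus)
  have swap: "(s \<otimes> x) \<otimes> plus y = s \<otimes> ?p \<otimes> x"
    using s c p by (simp add: m_assoc mult_plus)
  show ?thesis
  proof
    assume "s \<otimes> ?p = s"
    then show "s \<otimes> plus x = s \<and> (s \<otimes> x) \<otimes> plus y = s \<otimes> x"
      using below swap by simp
  next
    assume *: "s \<otimes> plus x = s \<and> (s \<otimes> x) \<otimes> plus y = s \<otimes> x"
    then have "s \<otimes> ?p \<otimes> plus x = s \<otimes> plus x"
      using swap s c p by (intro plus_cancel) (auto simp: m_closed)
    then show "s \<otimes> ?p = s" using below * by simp
  qed
qed

lemma right_translation_mult: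
  assumes c: "x \<in> carrier S" "y \<in> carrier S"
  shows "right_translation (x \<otimes> y) = right_translation y \<circ>\<^sub>m right_translation x"
proof
  fix s
  show "right_translation (x \<otimes> y) s = (right_translation y \<circ>\<^sub>m right_translation x) s"
    using plus_mult_fixed_iff[OF _ c, of s] c
    by (auto simp: right_translation_def map_comp_def m_assoc m_closed)
qed

text \<open>
  The element \<open>x\<close> is recovered as the image of \<open>x\<^sup>+\<close> under \<open>\<rho>\<^sub>x\<close>, and \<open>x\<^sup>+\<close> is determined by the
  domain of \<open>\<rho>\<^sub>x\<close>, in which it is the greatest idempotent.
\<close>

lemma right_translation_eqD:
  assumes c: "x \<in> carrier S" "y \<in> carrier S" and eq: "right_translation x = right_translation y"
  shows "x = y"
proof -
  have val: "right_translation z (plus z) = Some z" if "z \<in> carrier S" for z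
    using that plus_idempotent[OF that]
    by (simp add: right_translation_Some_iff idempotents_def plus_mult)
  have "right_translation y (plus x) = Some x" "right_translation x (plus y) = Some y"
    using val[OF c(1)] val[OF c(2)] eq by simp_all
  then have "plus x \<otimes> plus y = plus x" "x = plus x \<otimes> y" "plus y \<otimes> plus x = plus y"
    by (simp_all add: right_translation_Some_iff)
  then show ?thesis using idem_commute plus_idempotent plus_mult c by metis
qed

lemma right_translation_mon: "right_translation \<in> mon S (sym_inv_semigroup (carrier S))"
proof -
  have "right_translation (x \<otimes> y) =
      right_translation x \<otimes>\<^bsub>sym_inv_semigroup (carrier S)\<^esub> right_translation y"
    if "x \<in> carrier S" "y \<in> carrier S" for x y
    using right_translation_mult[OF that] by (simp add: sym_inv_semigroup_def)
  moreover have "inj_on right_translation (carrier S)"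
    by (rule inj_onI) (rule right_translation_eqD)
  ultimately show ?thesis
    by (auto simp: mon_def hom_def intro: right_translation_closed)
qed

lemma pinv_after_right_translation:
  assumes x: "x \<in> carrier S"
  shows "pinv (right_translation x) \<circ>\<^sub>m right_translation x = right_translation (plus x)"
proof
  fix s
  have "pinv (right_translation x) (s \<otimes> x) = Some s"
    if "s \<in> carrier S" "s \<otimes> plus x = s"
    using that by (simp add: pinv_Some_iff[OF inj_right_translation[OF x]] right_translation_Some_iff)
  then show "(pinv (right_translation x) \<circ>\<^sub>m right_translation x) s = right_translation (plus x) s"
    unfolding right_translation_idempotent[OF plus_idempotent[OF x]]
    by (auto simp: map_comp_def right_translation_def)
qed

text \<open>
  The composite is the identity on the image \<open>S x\<close> of \<open>\<rho>\<^sub>x\<close>, so it lies in the image of the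
  representation as soon as \<open>S x\<close> is also generated by an idempotent.
\<close>

lemma right_translation_after_pinv:
  assumes x: "x \<in> carrier S" and e: "e \<in> idempotents S"
    and ideals: "{s \<otimes> x |s. s \<in> carrier S} = {s \<otimes> e |s. s \<in> carrier S}"
  shows "right_translation x \<circ>\<^sub>m pinv (right_translation x) = right_translation e"
proof
  fix t
  note inj = inj_right_translation[OF x]
  have e': "e \<in> carrier S" "e \<otimes> e = e" using e by (simp_all add: idempotents_def)
  have "(\<exists>s. right_translation x s = Some t) \<longleftrightarrow> t \<in> {s \<otimes> x |s. s \<in> carrier S}"
  proof
    assume "t \<in> {s \<otimes> x |s. s \<in> carrier S}"
    then obtain s where s: "s \<in> carrier S" "t = s \<otimes> x" by blast
    \<comment> \<open>\<open>s\<close> itself may lie outside the domain; \<open>s x\<^sup>+\<close> lies in it and has the same image.\<close>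
    have "right_translation x (s \<otimes> plus x) = Some t"
      using s x plus_closed[OF x] plus_mult[OF x] plus_idempotent[OF x]
      by (simp add: right_translation_Some_iff m_closed m_assoc idempotents_def)
    then show "\<exists>s. right_translation x s = Some t" by blast
  qed (auto simp: right_translation_Some_iff)
  also have "\<dots> \<longleftrightarrow> t \<in> carrier S \<and> t \<otimes> e = t"
    unfolding ideals
  proof
    assume "t \<in> {s \<otimes> e |s. s \<in> carrier S}"
    then show "t \<in> carrier S \<and> t \<otimes> e = t" using e' by (auto simp: m_closed m_assoc)
  next
    assume "t \<in> carrier S \<and> t \<otimes> e = t"
    then show "t \<in> {s \<otimes> e |s. s \<in> carrier S}" by force
  qed
  finally have im: "(\<exists>s. right_translation x s = Some t) \<longleftrightarrow> t \<in> carrier S \<and> t \<otimes> e = t" .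
  show "(right_translation x \<circ>\<^sub>m pinv (right_translation x)) t = right_translation e t"
  proof (cases "\<exists>s. right_translation x s = Some t")
    case True
    then obtain s where "right_translation x s = Some t" by blast
    then show ?thesis
      using im unfolding right_translation_idempotent[OF e]
      by (auto simp: map_comp_def pinv_Some_iff[OF inj, THEN iffD2])
  next
    case False
    then show ?thesis
      using im unfolding right_translation_idempotent[OF e]
      by (auto simp: map_comp_def pinv_def)
  qed
qed

end

section \<open>Counting principal ideals\<close>

context alg_semigroup
begin

text \<open>
  Two elements that satisfy the same right cancellations (\<open>e\<close> a left identity of \<open>x\<close>) generate
  left ideals of equal size, matched by \<open>s e \<mapsto> s x\<close>.
\<close>

lemma card_left_ideal_eq:
  assumes c: "x \<in> carrier S" "e \<in> carrier S" and ex: "e \<otimes> x = x"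
    and cancel: "\<And>a b. \<lbrakk>a \<in> carrier S; b \<in> carrier S; a \<otimes> x = b \<otimes> x\<rbrakk> \<Longrightarrow> a \<otimes> e = b \<otimes> e"
  shows "card {s \<otimes> e |s. s \<in> carrier S} = card {s \<otimes> x |s. s \<in> carrier S}"
proof (rule bij_betw_same_card)
  have se: "(s \<otimes> e) \<otimes> x = s \<otimes> x" if "s \<in> carrier S" for s
    using that c ex by (simp add: m_assoc)
  show "bij_betw (\<lambda>t. t \<otimes> x) {s \<otimes> e |s. s \<in> carrier S} {s \<otimes> x |s. s \<in> carrier S}"
    unfolding bij_betw_def
  proof
    show "inj_on (\<lambda>t. t \<otimes> x) {s \<otimes> e |s. s \<in> carrier S}"
      by (rule inj_onI) (auto simp: se intro: cancel)
    show "(\<lambda>t. t \<otimes> x) ` {s \<otimes> e |s. s \<in> carrier S} = {s \<otimes> x |s. s \<in> carrier S}"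
      by (simp add: Setcompr_eq_image image_image se cong: image_cong_simp)
  qed
qed

lemma card_right_ideal_eq:
  assumes c: "x \<in> carrier S" "e \<in> carrier S" and xe: "x \<otimes> e = x"
    and cancel: "\<And>a b. \<lbrakk>a \<in> carrier S; b \<in> carrier S; x \<otimes> a = x \<otimes> b\<rbrakk> \<Longrightarrow> e \<otimes> a = e \<otimes> b"
  shows "card {e \<otimes> s |s. s \<in> carrier S} = card {x \<otimes> s |s. s \<in> carrier S}"
proof (rule bij_betw_same_card)
  have es: "x \<otimes> (e \<otimes> s) = x \<otimes> s" if "s \<in> carrier S" for s
    using that c xe by (simp add: m_assoc[symmetric])
  show "bij_betw (\<lambda>t. x \<otimes> t) {e \<otimes> s |s. s \<in> carrier S} {x \<otimes> s |s. s \<in> carrier S}"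
    unfolding bij_betw_def
  proof
    show "inj_on (\<lambda>t. x \<otimes> t) {e \<otimes> s |s. s \<in> carrier S}"
      by (rule inj_onI) (auto simp: es intro: cancel)
    show "(\<lambda>t. x \<otimes> t) ` {e \<otimes> s |s. s \<in> carrier S} = {x \<otimes> s |s. s \<in> carrier S}"
      by (simp add: Setcompr_eq_image image_image es cong: image_cong_simp)
  qed
qed

end

text \<open>
  With \<open>p = x\<^sup>+\<close> and \<open>e = x\<^sup>*\<close>, the inclusion \<open>S x \<subseteq> S e\<close> is an equality because
  \<open>|S e| = |e S| = |x S| \<le> |p S| = |S p| = |S x|\<close>.
\<close>

lemma (in left_ample_plus) left_ideal_eq_idempotent_left_ideal:
  assumes fin: "finite (carrier S)"
    and balanced: "\<And>f. f \<in> idempotents S \<Longrightarrow>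
      card {f \<otimes> s |s. s \<in> carrier S} = card {s \<otimes> f |s. s \<in> carrier S}"
    and x: "x \<in> carrier S" and e: "e \<in> idempotents S" and xe: "x \<otimes> e = x"
    and cancel: "\<And>a b. \<lbrakk>a \<in> carrier S; b \<in> carrier S; x \<otimes> a = x \<otimes> b\<rbrakk> \<Longrightarrow> e \<otimes> a = e \<otimes> b"
  shows "{s \<otimes> x |s. s \<in> carrier S} = {s \<otimes> e |s. s \<in> carrier S}"
proof (rule card_seteq)
  have e': "e \<in> carrier S" using e by (simp add: idempotents_def)
  have p: "plus x \<in> carrier S" using x by (rule plus_closed)
  show "finite {s \<otimes> e |s. s \<in> carrier S}" using fin by simp
  show "{s \<otimes> x |s. s \<in> carrier S} \<subseteq> {s \<otimes> e |s. s \<in> carrier S}"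
  proof
    fix t assume "t \<in> {s \<otimes> x |s. s \<in> carrier S}"
    then have "t \<in> carrier S" "t = t \<otimes> e" using x e' xe by (auto simp: m_assoc m_closed)
    then show "t \<in> {s \<otimes> e |s. s \<in> carrier S}" by (intro CollectI exI conjI)
  qed
  have sub: "{x \<otimes> s |s. s \<in> carrier S} \<subseteq> {plus x \<otimes> s |s. s \<in> carrier S}"
  proof
    fix t assume "t \<in> {x \<otimes> s |s. s \<in> carrier S}"
    then have "t \<in> carrier S" "t = plus x \<otimes> t"
      using x p plus_mult[OF x] by (auto simp: m_assoc[symmetric] m_closed)
    then show "t \<in> {plus x \<otimes> s |s. s \<in> carrier S}" by (intro CollectI exI conjI)
  qed
  have "card {e \<otimes> s |s. s \<in> carrier S} = card {x \<otimes> s |s. s \<in> carrier S}"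
    by (rule card_right_ideal_eq) (fact x e' xe cancel)+
  then have "card {s \<otimes> e |s. s \<in> carrier S} = card {x \<otimes> s |s. s \<in> carrier S}"
    unfolding balanced[OF e] .
  also have "\<dots> \<le> card {plus x \<otimes> s |s. s \<in> carrier S}"
    using fin sub by (intro card_mono) simp_all
  also have "\<dots> = card {s \<otimes> plus x |s. s \<in> carrier S}"
    by (rule balanced[OF plus_idempotent[OF x]])
  also have "\<dots> = card {s \<otimes> x |s. s \<in> carrier S}"
    using x p by (intro card_left_ideal_eq plus_mult plus_cancel)
  finally show "card {s \<otimes> e |s. s \<in> carrier S} \<le> card {s \<otimes> x |s. s \<in> carrier S}" .
qed

section \<open>The embedding theorem\<close>

theorem theorem2p8:
  fixes S :: "('a, 'm) monoid_scheme"
  assumes "alg_semigroup S"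
    and "finite (carrier S)"
    and "ample TYPE('b) TYPE('c) S"
    and "\<forall>e \<in> idempotents S. \<exists>f. bij_betw f
          {e \<otimes>\<^bsub>S\<^esub> s |s. s \<in> carrier S} {s \<otimes>\<^bsub>S\<^esub> e |s. s \<in> carrier S}"
  shows "\<exists>\<phi> \<in> mon S (sym_inv_semigroup (carrier S)). \<forall>x \<in> carrier S.
    \<phi> x \<otimes>\<^bsub>sym_inv_semigroup (carrier S)\<^esub> sinv (sym_inv_semigroup (carrier S)) (\<phi> x)
      \<in> \<phi> ` carrier S \<and>
    sinv (sym_inv_semigroup (carrier S)) (\<phi> x) \<otimes>\<^bsub>sym_inv_semigroup (carrier S)\<^esub> \<phi> x
      \<in> \<phi> ` carrier S"
proof -
  have la: "left_ample TYPE('b) S" and ra: "right_ample TYPE('c) S"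
    using assms(3) by (simp_all add: ample_def)
  obtain plus where "left_ample_plus S plus"
    using left_ample_imp_plus[OF assms(1) la] by blast
  then interpret left_ample_plus S plus .
  have balanced: "card {f \<otimes>\<^bsub>S\<^esub> s |s. s \<in> carrier S} = card {s \<otimes>\<^bsub>S\<^esub> f |s. s \<in> carrier S}"
    if "f \<in> idempotents S" for f
    using assms(4) that bij_betw_same_card by blast
  have mult: "\<beta> \<otimes>\<^bsub>sym_inv_semigroup (carrier S)\<^esub> \<gamma> = \<gamma> \<circ>\<^sub>m \<beta>" for \<beta> \<gamma>
    by (simp add: sym_inv_semigroup_def)
  show ?thesis
  proof (intro bexI[OF _ right_translation_mon] ballI)
    fix x assume x: "x \<in> carrier S"
    obtain e where e: "e \<in> idempotents S" "x \<otimes>\<^bsub>S\<^esub> e = x"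
      and cancel: "\<And>a b. \<lbrakk>a \<in> carrier S; b \<in> carrier S; x \<otimes>\<^bsub>S\<^esub> a = x \<otimes>\<^bsub>S\<^esub> b\<rbrakk>
        \<Longrightarrow> e \<otimes>\<^bsub>S\<^esub> a = e \<otimes>\<^bsub>S\<^esub> b"
      using right_ample_imp_star[OF assms(1) ra x] by metis
    have "right_translation x \<circ>\<^sub>m pinv (right_translation x) = right_translation e"
      by (intro right_translation_after_pinv left_ideal_eq_idempotent_left_ideal
          x e cancel balanced assms(2))
    moreover have "e \<in> carrier S" using e by (simp add: idempotents_def)
    ultimately show "right_translation x \<otimes>\<^bsub>sym_inv_semigroup (carrier S)\<^esub>
          sinv (sym_inv_semigroup (carrier S)) (right_translation x)
          \<in> right_translation ` carrier S \<and>
        sinv (sym_inv_semigroup (carrier S)) (right_translation x)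
          \<otimes>\<^bsub>sym_inv_semigroup (carrier S)\<^esub> right_translation x
          \<in> right_translation ` carrier S"
      using pinv_after_right_translation[OF x] plus_closed[OF x]
      by (simp add: mult sinv_sym_inv_semigroup right_translation_closed[OF x])
  qed
qed

end
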